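(* Let $X\neq\{0\}$ be a real Hilbert space that is not one-dimensional, and let $e\in X$ satisfy $\|e\|=1$. Then the following hold: (i) $A_e$ is not paramonotone. Consequently, $A_e$ is neither strictly monotone nor strongly monotone. (ii) $A_e$ is not $3^*$ monotone.
   Context: For $e$ in a real Hilbert space $X\ne\{0\}$ with $\|e\|\le 1$, define $R_e\colon X\to X\colon x\mapsto \|x\|\,e$ and $T_e\colon X\to X\colon x\mapsto \tfrac12 x+\tfrac12 R_e x=\tfrac12x+\tfrac12\|x\|e$. The map $R_e$ is nonexpansive, so $T_e$ is firmly nonexpansive and is the resolvent $J_{A_e}=(\mathrm{Id}+A_e)^{-1}$ of the maximally monotone set-valued operator $A_e=T_e^{-1}-\mathrm{Id}$ (inverse in the sense of set-valued operators); equivalently, the graph of $A_e$ is $\operatorname{gra}A_e=\{(T_ey,\,y-T_ey) : y\in X\}$. Let $A\colon X\rightrightarrows X$ be monotone. $A$ is paramonotone if for all $(x,u),(y,v)\in\operatorname{gra}A$ with $\langle x-y,u-v\rangle=0$ one has $(x,v)\in\operatorname{gra}A$ and $(y,u)\in\operatorname{gra}A$. $A$ is strictly monotone if $\langle x-y,u-v\rangle>0$ for all $(x,u),(y,v)\in\operatorname{gra}A$ with $x\neq y$. $A$ is strongly monotone if there is $\beta>0$ with $\langle x-y,u-v\rangle\ge\beta\|x-y\|^2$ for all $(x,u),(y,v)\in\operatorname{gra}A$. $A$ is $3^*$ monotone if for all $x\in\operatorname{dom}A$ and all $u\in\operatorname{ran}A$, $\inf_{(z,w)\in\operatorname{gra}A}\langle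 x-z,u-w\rangle>-\infty$. *)

theory Defs
  imports "HOL-Analysis.Analysis"
begin

text \<open>A set-valued operator on \<open>X\<close> is a function \<^typ>\<open>'a \<Rightarrow> 'a set\<close>.\<close>

type_synonym 'a set_op = "'a \<Rightarrow> 'a set"

definition gra :: "'a set_op \<Rightarrow> ('a \<times> 'a) set" where
  "gra A = {(x, u). u \<in> A x}"

definition dom_op :: "'a set_op \<Rightarrow> 'a set" where
  "dom_op A = {x. A x \<noteq> {}}"

definition ran_op :: "'a set_op \<Rightarrow> 'a set" where
  "ran_op A = (\<Union>x. A x)"

definition inverse_op :: "'a set_op \<Rightarrow> 'a set_op" where
  "inverse_op A = (\<lambda>u. {x. u \<in> A x})"

definition minus_Id :: "'a::real_vector set_op \<Rightarrow> 'a set_op" where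
  "minus_Id A = (\<lambda>x. {u - x | u. u \<in> A x})"

definition monotone_op :: "'a::real_inner set_op \<Rightarrow> bool" where
  "monotone_op A \<longleftrightarrow> (\<forall>(x, u) \<in> gra A. \<forall>(y, v) \<in> gra A. inner (x - y) (u - v) \<ge> 0)"

text \<open>The following four notions are meant for monotone operators. Monotonicity is not
  repeated in them, so that their negations cannot hold merely because it fails.\<close>

definition paramonotone :: "'a::real_inner set_op \<Rightarrow> bool" where
  "paramonotone A \<longleftrightarrow> (\<forall>(x, u) \<in> gra A. \<forall>(y, v) \<in> gra A.
     inner (x - y) (u - v) = 0 \<longrightarrow> (x, v) \<in> gra A \<and> (y, u) \<in> gra A)"

definition strictly_monotone :: "'a::real_inner set_op \<Rightarrow> bool" where
  "strictly_monotone A \<longleftrightarrow> (\<forall>(x, u) \<in> gra A. \<forall>(y, v) \<in> gra A.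
     x \<noteq> y \<longrightarrow> inner (x - y) (u - v) > 0)"

definition strongly_monotone :: "'a::real_inner set_op \<Rightarrow> bool" where
  "strongly_monotone A \<longleftrightarrow> (\<exists>\<beta>>0. \<forall>(x, u) \<in> gra A. \<forall>(y, v) \<in> gra A.
     inner (x - y) (u - v) \<ge> \<beta> * (norm (x - y))\<^sup>2)"

definition three_star_monotone :: "'a::real_inner set_op \<Rightarrow> bool" where
  "three_star_monotone A \<longleftrightarrow> (\<forall>x \<in> dom_op A. \<forall>u \<in> ran_op A.
     (INF (z, w) \<in> gra A. ereal (inner (x - z) (u - w))) > -\<infinity>)"

definition R_map :: "'a::real_normed_vector \<Rightarrow> 'a \<Rightarrow> 'a" where
  "R_map e x = norm x *\<^sub>R e"

definition T_map :: "'a::real_normed_vector \<Rightarrow> 'a \<Rightarrow> 'a" where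
  "T_map e x = (1/2) *\<^sub>R x + (1/2) *\<^sub>R R_map e x"

definition A_op :: "'a::real_normed_vector \<Rightarrow> 'a set_op" where
  "A_op e = minus_Id (inverse_op (\<lambda>x. {T_map e x}))"

lemma gra_A_op: "gra (A_op e) = {(T_map e y, y - T_map e y) | y. True}"
  by (auto simp: gra_def A_op_def minus_Id_def inverse_op_def)

lemma monotone_A_op:
  fixes e :: "'a::real_inner"
  assumes "norm e \<le> 1"
  shows "monotone_op (A_op e)"
proof -
  have "inner (T_map e x - T_map e y) ((x - T_map e x) - (y - T_map e y)) \<ge> 0" for x y
  proof -
    define d r where "d = x - y" and "r = R_map e x - R_map e y"
    have "r = (norm x - norm y) *\<^sub>R e"
      by (simp add: r_def R_map_def scaleR_left_diff_distrib)
    then have "norm r = \<bar>norm x - norm y\<bar> * norm e"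
      by simp
    also have "\<dots> \<le> \<bar>norm x - norm y\<bar> * 1"
      using assms by (intro mult_left_mono) auto
    also have "\<dots> \<le> norm d"
      by (simp add: d_def norm_triangle_ineq3)
    finally have "inner r r \<le> inner d d"
      by (simp add: norm_le)
    moreover have "T_map e x - T_map e y = (1/2) *\<^sub>R (d + r)"
      by (simp add: T_map_def d_def r_def algebra_simps)
    moreover have "(x - T_map e x) - (y - T_map e y) = d - (T_map e x - T_map e y)"
      by (simp add: d_def)
    moreover have "d - (1/2) *\<^sub>R (d + r) = (1/2) *\<^sub>R (d - r)"
      using scaleR_left_distrib[of "1/2" "1/2" d] by (simp add: algebra_simps)
    ultimately show ?thesis
      by (simp add: inner_add_left inner_add_right inner_diff_left inner_diff_right inner_commute)
  qed
  then show ?thesis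
    by (auto simp: monotone_op_def gra_A_op)
qed

text \<open>Pitfall: \<^const>\<open>dim\<close> is the cardinality of a Hamel basis, as a natural number, and thus \<open>0\<close> for
  infinite-dimensional spaces. So \<open>dim UNIV \<noteq> 1\<close> excludes exactly the one-dimensional spaces.\<close>

end

theory Submission
  imports Defs
begin

text \<open>The points of the graph of \<open>A_op e\<close> are \<open>((y + \<parallel>y\<parallel> e) / 2, (y - \<parallel>y\<parallel> e) / 2)\<close>. Since
  \<open>\<parallel>e\<parallel> = 1\<close>, the two components of each of them are orthogonal. As \<open>(0, 0)\<close> also lies in the
  graph, every graph point pairs with \<open>(0, 0)\<close> to the inner product zero, and paramonotonicity would
  put \<open>(0, (y - \<parallel>y\<parallel> e) / 2)\<close> in the graph for every \<open>y\<close>. But the values of \<open>A_op e\<close> at \<open>0\<close> are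
  multiples of \<open>e\<close> (lemma \<open>A_op_zero_in_line\<close>), which fails for any \<open>y\<close> outside the line through
  \<open>e\<close>. Such a \<open>y\<close> exists because the space is not one-dimensional; a unit vector \<open>f\<close> orthogonal to
  \<open>e\<close> is convenient (lemma \<open>ex_orthogonal_unit\<close>). Strong monotonicity implies strict monotonicity,
  which implies paramonotonicity, so all three fail together.

  The same orthogonality refutes \<open>3*\<close> monotonicity. For \<open>0\<close> in the domain, \<open>u\<close> in the range and a
  graph point \<open>(z, w)\<close>, the expression \<open>\<langle>0 - z, u - w\<rangle>\<close> is just \<open>- \<langle>z, u\<rangle>\<close>, which is positively
  homogeneous in the parameter \<open>y\<close> of the point. Hence its infimum is \<open>-\<infinity>\<close> as soon as it is negative
  once. Twice \<open>\<langle>z, u\<rangle>\<close> is \<open>\<langle>y, u\<rangle> + \<parallel>y\<parallel> \<langle>e, u\<rangle>\<close>, which is positive for \<open>y = u\<close> by the strict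
  Cauchy-Schwarz inequality unless \<open>u\<close> is a nonpositive multiple of \<open>e\<close>; the range contains
  \<open>u = (f - e) / 2\<close>, which is not.\<close>

lemma strongly_imp_strictly_monotone:
  assumes "strongly_monotone A"
  shows "strictly_monotone A"
proof -
  obtain \<beta> where \<beta>: "\<beta> > 0"
    and bound: "\<And>x u y v. (x, u) \<in> gra A \<Longrightarrow> (y, v) \<in> gra A \<Longrightarrow>
      inner (x - y) (u - v) \<ge> \<beta> * (norm (x - y))\<^sup>2"
    using assms unfolding strongly_monotone_def by fast
  have "inner (x - y) (u - v) > 0" if "(x, u) \<in> gra A" "(y, v) \<in> gra A" "x \<noteq> y" for x u y v
  proof -
    have "0 < \<beta> * (norm (x - y))\<^sup>2"
      using \<beta> that(3) by simp
    also have "\<dots> \<le> inner (x - y) (u - v)"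
      using bound that(1,2) by blast
    finally show ?thesis .
  qed
  then show ?thesis
    unfolding strictly_monotone_def by fast
qed

text \<open>Under strict monotonicity a vanishing inner product forces \<open>x = y\<close>, and then exchanging the
  values at \<open>x\<close> and \<open>y\<close> changes nothing.\<close>

lemma strictly_imp_paramonotone:
  assumes "strictly_monotone A"
  shows "paramonotone A"
proof -
  have "x = y" if "(x, u) \<in> gra A" "(y, v) \<in> gra A" "inner (x - y) (u - v) = 0" for x u y v
    using assms that unfolding strictly_monotone_def by fastforce
  then show ?thesis
    unfolding paramonotone_def by blast
qed

lemma ex_orthogonal_unit:
  fixes e :: "'a::real_inner"
  assumes "dim (UNIV :: 'a set) \<noteq> 1" and "norm e = 1"
  obtains f :: 'a where "norm f = 1" and "inner e f = 0"
proof -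
  have "e \<noteq> 0"
    using assms(2) by auto
  then have "dim (span {e}) = 1"
    by (simp add: dim_eq_card_independent dim_span)
  then obtain x where x: "x \<notin> span {e}"
    using assms(1) by (metis UNIV_eq_I)
  define g where "g = x - inner x e *\<^sub>R e"
  have "g \<noteq> 0"
    using x by (auto simp: g_def span_singleton)
  have "inner e e = 1"
    using assms(2) by (simp add: dot_square_norm)
  then have "inner e g = 0"
    by (simp add: g_def inner_diff_right inner_commute)
  then show ?thesis
    using \<open>g \<noteq> 0\<close> by (intro that[of "g /\<^sub>R norm g"]) auto
qed

lemma gra_A_op_iff:
  fixes e :: "'a::real_inner"
  shows "(z, w) \<in> gra (A_op e) \<longleftrightarrow>
    (\<exists>y. z = (1/2) *\<^sub>R (y + norm y *\<^sub>R e) \<and> w = (1/2) *\<^sub>R (y - norm y *\<^sub>R e))"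
proof -
  have "T_map e y = (1/2) *\<^sub>R (y + norm y *\<^sub>R e)" for y
    by (simp add: T_map_def R_map_def scaleR_right_distrib)
  moreover have "y - (1/2) *\<^sub>R (y + norm y *\<^sub>R e) = (1/2) *\<^sub>R (y - norm y *\<^sub>R e)" for y
    using scaleR_left_distrib[of "1/2" "1/2" y] by (simp add: algebra_simps)
  ultimately show ?thesis
    by (auto simp: gra_A_op)
qed

lemma A_op_orthogonal:
  fixes e :: "'a::real_inner"
  assumes "norm e = 1" and "(z, w) \<in> gra (A_op e)"
  shows "inner z w = 0"
proof -
  obtain y where "z = (1/2) *\<^sub>R (y + norm y *\<^sub>R e)" "w = (1/2) *\<^sub>R (y - norm y *\<^sub>R e)"
    using assms(2) by (auto simp: gra_A_op_iff)
  moreover have "inner (y + a) (y - a) = (norm y)\<^sup>2 - (norm a)\<^sup>2" for a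
    by (simp add: inner_add_left inner_diff_right inner_commute[of a y] power2_norm_eq_inner)
  ultimately show ?thesis
    using assms(1) by simp
qed

lemma zero_in_gra_A_op: "(0, 0) \<in> gra (A_op (e :: 'a::real_inner))"
  unfolding gra_A_op_iff by (intro exI[of _ 0]) simp

text \<open>\<open>T_map e y = 0\<close> means \<open>y = - \<parallel>y\<parallel> e\<close>, and then the value at \<open>0\<close> is \<open>y\<close> itself.\<close>

lemma A_op_zero_in_line:
  fixes e :: "'a::real_inner"
  assumes "(0, w) \<in> gra (A_op e)"
  obtains c where "w = c *\<^sub>R e"
proof -
  obtain y where "y + norm y *\<^sub>R e = 0" and w: "w = (1/2) *\<^sub>R (y - norm y *\<^sub>R e)"
    using assms by (auto simp: gra_A_op_iff)
  then have y: "y = - (norm y *\<^sub>R e)"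
    by (simp add: eq_neg_iff_add_eq_0)
  have "w = (1/2) *\<^sub>R (- (norm y *\<^sub>R e) - norm y *\<^sub>R e)"
    unfolding w by (subst y) simp
  also have "\<dots> = (- norm y) *\<^sub>R e"
    by (simp only: diff_conv_add_uminus scaleR_half_double scaleR_minus_left)
  finally show ?thesis
    by (rule that)
qed

lemma not_paramonotone_A_op:
  fixes e f :: "'a::real_inner"
  assumes "norm e = 1" and "norm f = 1" and "inner e f = 0"
  shows "\<not> paramonotone (A_op e)"
proof
  assume para: "paramonotone (A_op e)"
  define z w where "z = (1/2) *\<^sub>R (f + e)" and "w = (1/2) *\<^sub>R (f - e)"
  have zw: "(z, w) \<in> gra (A_op e)"
    unfolding gra_A_op_iff z_def w_def using assms(2) by (intro exI[of _ f]) simp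
  moreover have "inner (z - 0) (w - 0) = 0"
    using A_op_orthogonal[OF assms(1) zw] by simp
  ultimately have "(0, w) \<in> gra (A_op e)"
    using para zero_in_gra_A_op[of e] unfolding paramonotone_def by blast
  then obtain c where c: "w = c *\<^sub>R e"
    by (rule A_op_zero_in_line)
  have "inner w f = 1/2"
    using assms by (simp add: w_def inner_diff_left dot_square_norm)
  then show False
    using c assms(3) by simp
qed

text \<open>With \<open>u = (f - e) / 2\<close>, the witness is the ray spanned by \<open>3 f - 4 e\<close>. Any direction close to
  \<open>u\<close> would do; this one has the rational norm \<open>5\<close>, so that \<open>\<langle>z, u\<rangle>\<close> comes out as \<open>t / 2\<close> at the
  parameter \<open>t (3 f - 4 e)\<close>.\<close>

lemma not_three_star_monotone_A_op:
  fixes e f :: "'a::real_inner"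
  assumes "norm e = 1" and "norm f = 1" and "inner e f = 0"
  shows "\<not> three_star_monotone (A_op e)"
proof
  assume star: "three_star_monotone (A_op e)"
  define u where "u = (1/2) *\<^sub>R (f - e)"
  have ips: "inner e e = 1" "inner f f = 1" "inner e f = 0" "inner f e = 0"
    using assms by (simp_all add: dot_square_norm inner_commute)
  define I where "I = (INF (z, w) \<in> gra (A_op e). ereal (inner (0 - z) (u - w)))"
  have "0 \<in> dom_op (A_op e)"
    using zero_in_gra_A_op[of e] by (auto simp: dom_op_def gra_def)
  moreover have "u \<in> ran_op (A_op e)"
  proof -
    have "((1/2) *\<^sub>R (f + e), u) \<in> gra (A_op e)"
      unfolding gra_A_op_iff u_def using assms(2) by (intro exI[of _ f]) simp
    then show ?thesis
      by (auto simp: ran_op_def gra_def)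
  qed
  ultimately have "I > -\<infinity>"
    using star unfolding three_star_monotone_def I_def by blast
  moreover have "I \<le> ereal r" for r
  proof -
    define t where "t = 2 * \<bar>r\<bar>"
    define y where "y = t *\<^sub>R (3 *\<^sub>R f - 4 *\<^sub>R e)"
    define z w where "z = (1/2) *\<^sub>R (y + norm y *\<^sub>R e)" and "w = (1/2) *\<^sub>R (y - norm y *\<^sub>R e)"
    have "norm (3 *\<^sub>R f - 4 *\<^sub>R e) = sqrt (5\<^sup>2)"
      by (simp add: norm_eq_sqrt_inner inner_diff_left inner_diff_right ips)
    then have norm_y: "norm y = 5 * t"
      by (simp add: y_def t_def)
    have zw: "(z, w) \<in> gra (A_op e)"
      unfolding gra_A_op_iff z_def w_def by blast
    have "inner z u = t / 2"
      unfolding z_def norm_y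
      by (simp add: y_def u_def inner_add_left inner_diff_left inner_diff_right ips algebra_simps)
    then have "inner (0 - z) (u - w) = - \<bar>r\<bar>"
      using A_op_orthogonal[OF assms(1) zw] by (simp add: t_def inner_diff_right)
    then have "I \<le> ereal (- \<bar>r\<bar>)"
      unfolding I_def using zw by (intro INF_lower2[of "(z, w)"]) auto
    then show ?thesis
      by (rule order_trans) simp
  qed
  ultimately show False
    using ereal_bot by auto
qed

theorem proposition3p2:
  fixes e :: "'a::{real_inner, complete_space}"
  assumes "(UNIV :: 'a set) \<noteq> {0}"
    and "dim (UNIV :: 'a set) \<noteq> 1"
    and "norm e = 1"
  shows "(\<not> paramonotone (A_op e) \<and> \<not> strictly_monotone (A_op e) \<and> \<not> strongly_monotone (A_op e))
    \<and> \<not> three_star_monotone (A_op e)"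
proof -
  obtain f :: 'a where f: "norm f = 1" "inner e f = 0"
    using ex_orthogonal_unit[OF assms(2,3)] .
  show ?thesis
    using not_paramonotone_A_op[OF assms(3) f] not_three_star_monotone_A_op[OF assms(3) f]
      strictly_imp_paramonotone strongly_imp_strictly_monotone by blast
qed

end
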